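(* Let $G$ be a linear time-invariant system $\dot x=Ax+Bv$, $w=Cx+Dv$ with input $v=\mathrm{col}(v_A,v_B)$ and output $w=\mathrm{col}(w_A,w_B)$, where $v_A(t),w_B(t)\in\mathbb{R}^p$ and $v_B(t),w_A(t)\in\mathbb{R}^q$. Let $G$ be strictly dissipative with respect to a quadratic supply function of the additive form $s(v,w)=s_A(v_A,w_A)+s_B(v_B,w_B)$ with a quadratic storage function $V(x)=x^\top Px$. Suppose that a) $s_A(v_A,w_A)+s_B(v_B,w_B)=0$ for all $v_A=w_B$, $v_B=w_A$; b) $s_A(0,w_A)\le0$ for all $w_A\neq0$, and $s_B(0,w_B)\le0$ for all $w_B\neq0$; c) $P\succ0$. Then the system $G$ is stable, and for every $\alpha\in[0,1]$ it remains stable if the interconnection $v_A=\alpha w_B$, $v_B=\alpha w_A$ is made.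
   Context: All matrices are real. Quadratic supply functions are quadratic forms; $P$ is symmetric. The linear system $\dot x=Ax+Bv$, $w=Cx+Dv$ is strictly dissipative with respect to $s(v,w)$ with storage function $V(x)=x^\top Px$ if $2x^\top P(Ax+Bv)<s(v,\,Cx+Dv)$ for all $(x,v)\neq0$. "Stable" means asymptotically stable; stability of $G$ itself refers to $v=0$, i.e. to $\dot x=Ax$. For the interconnection $v=Hw$ with $H=\begin{pmatrix}0&\alpha I\\ \alpha I&0\end{pmatrix}$, stability is understood to include well-posedness (invertibility of $I-DH$), and refers to the resulting autonomous system $\dot x=(A+BH(I-DH)^{-1}C)x$. *)

theory Defs
  imports "HOL-Analysis.Analysis"
begin

definition col :: "real^'a \<Rightarrow> real^'b \<Rightarrow> real^('a::finite + 'b::finite)" where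
  "col x y = (\<chi> i. case i of Inl a \<Rightarrow> x $ a | Inr b \<Rightarrow> y $ b)"

definition upper :: "real^('a::finite + 'b::finite) \<Rightarrow> real^'a" where
  "upper z = (\<chi> a. z $ Inl a)"

definition lower :: "real^('a::finite + 'b::finite) \<Rightarrow> real^'b" where
  "lower z = (\<chi> b. z $ Inr b)"

lemma col_simps [simp]:
  "upper (col x y) = x" "lower (col x y) = y" "col (upper z) (lower z) = z"
  by (auto simp: upper_def lower_def col_def vec_eq_iff split: sum.split)

definition quadratic_form :: "('a::real_vector \<Rightarrow> real) \<Rightarrow> bool" where
  "quadratic_form q \<longleftrightarrow> (\<exists>b. bilinear b \<and> (\<forall>z. q z = b z z))"

definition additive_supply ::
  "(real^'p \<Rightarrow> real^'q \<Rightarrow> real) \<Rightarrow> (real^'q \<Rightarrow> real^'p \<Rightarrow> real)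
    \<Rightarrow> real^('p::finite + 'q::finite) \<Rightarrow> real^('q::finite + 'p::finite) \<Rightarrow> real" where
  "additive_supply sA sB v w = sA (upper v) (upper w) + sB (lower v) (lower w)"

definition pos_definite :: "real^'n^'n \<Rightarrow> bool" where
  "pos_definite P \<longleftrightarrow> transpose P = P \<and> (\<forall>x. x \<noteq> 0 \<longrightarrow> x \<bullet> (P *v x) > 0)"

text \<open>For symmetric \<open>P\<close> the left-hand side is the derivative of the storage function
  \<open>V x = x \<bullet> (P *v x)\<close> along \<open>x' = A x + B v\<close>.\<close>

definition strictly_dissipative ::
  "real^'n^'n \<Rightarrow> real^'m^'n \<Rightarrow> real^'n^'k \<Rightarrow> real^'m^'k
    \<Rightarrow> (real^'m \<Rightarrow> real^'k \<Rightarrow> real) \<Rightarrow> real^'n^'n \<Rightarrow> bool" where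
  "strictly_dissipative A B C D s P \<longleftrightarrow>
    (\<forall>x v. (x, v) \<noteq> (0, 0) \<longrightarrow>
      2 * (x \<bullet> (P *v (A *v x + B *v v))) < s v (C *v x + D *v v))"

definition is_trajectory :: "real^'n^'n \<Rightarrow> (real \<Rightarrow> real^'n) \<Rightarrow> bool" where
  "is_trajectory M x \<longleftrightarrow>
    (\<forall>t\<ge>0. (x has_vector_derivative M *v x t) (at t within {0..}))"

text \<open>Asymptotic stability of the origin for \<open>x' = M x\<close>: Lyapunov stability together with
  attractivity. Every initial value has a trajectory on all of \<open>{0..}\<close>, so quantifying over
  global trajectories loses nothing.\<close>

definition asymptotically_stable :: "real^'n^'n \<Rightarrow> bool" where
  "asymptotically_stable M \<longleftrightarrow>
    (\<forall>\<epsilon>>0. \<exists>\<delta>>0. \<forall>x. is_trajectory M x \<and> norm (x 0) < \<delta> \<longrightarrow> (\<forall>t\<ge>0. norm (x t) < \<epsilon>)) \<and>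
    (\<exists>\<delta>>0. \<forall>x. is_trajectory M x \<and> norm (x 0) < \<delta> \<longrightarrow> (x \<longlongrightarrow> 0) at_top)"

text \<open>The interconnection \<open>v = H w\<close> with \<open>H = (0, \<alpha> I; \<alpha> I, 0)\<close>.\<close>

definition coupling :: "real \<Rightarrow> real^('q::finite + 'p::finite)^('p::finite + 'q::finite)" where
  "coupling \<alpha> = (\<chi> i j. case (i, j) of
      (Inl a, Inr b) \<Rightarrow> if a = b then \<alpha> else 0
    | (Inr a, Inl b) \<Rightarrow> if a = b then \<alpha> else 0
    | _ \<Rightarrow> 0)"

lemma coupling_mult_col:
  "coupling \<alpha> *v col wA wB = col (\<alpha> *\<^sub>R wB) (\<alpha> *\<^sub>R wA)"
proof -
  have "(\<Sum>j\<in>UNIV. f j) = (\<Sum>a\<in>UNIV. f (Inl a)) + (\<Sum>b\<in>UNIV. f (Inr b))"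
    for f :: "'b::finite + 'a::finite \<Rightarrow> real"
    by (simp add: UNIV_Plus_UNIV [symmetric] sum.Plus del: UNIV_Plus_UNIV)
  then show ?thesis
    by (auto simp: vec_eq_iff matrix_vector_mult_def coupling_def col_def if_distrib
        if_distribR sum.delta sum.delta' cong: if_cong split: sum.split)
qed

definition well_posed :: "real^'m^'k \<Rightarrow> real^'k^'m \<Rightarrow> bool" where
  "well_posed D H \<longleftrightarrow> invertible (mat 1 - D ** H)"

definition closed_loop ::
  "real^'n^'n \<Rightarrow> real^'m^'n \<Rightarrow> real^'n^'k \<Rightarrow> real^'m^'k \<Rightarrow> real^'k^'m \<Rightarrow> real^'n^'n" where
  "closed_loop A B C D H = A + B ** H ** matrix_inv (mat 1 - D ** H) ** C"

definition interconnection_stable ::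
  "real^'n^'n \<Rightarrow> real^'m^'n \<Rightarrow> real^'n^'k \<Rightarrow> real^'m^'k \<Rightarrow> real^'k^'m \<Rightarrow> bool" where
  "interconnection_stable A B C D H \<longleftrightarrow>
    well_posed D H \<and> asymptotically_stable (closed_loop A B C D H)"

end

(* Splitting the additive supply into forms in (v_A, w_A) and (v_B, w_B), hypothesis (a) forces the
   mixed terms to cancel, because these change sign under w_A -> -w_A while the pure terms do
   not.  Under v = alpha H w the supply is therefore (1 - alpha^2) times its value at (0, w), which
   is nonpositive by (b).  So V strictly decreases along every closed loop with alpha in [0, 1];
   applied to x = 0, strict dissipativity also excludes a kernel of I - D H. *)

theory Submission
  imports Defs
begin

section \<open>Coercivity of quadratic forms and Lyapunov stability of linear systems\<close>

text \<open>By compactness \<open>f\<close> attains a positive minimum on the unit sphere, and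
  homogeneity carries this minimum to every vector.\<close>

lemma quadratic_lower_bound:
  fixes f :: "'a::euclidean_space \<Rightarrow> real"
  assumes cont: "continuous_on UNIV f"
    and scale: "\<And>c x. f (c *\<^sub>R x) = c\<^sup>2 * f x"
    and pos: "\<And>x. x \<noteq> 0 \<Longrightarrow> f x > 0"
  obtains m where "m > 0" "\<And>x. m * (norm x)\<^sup>2 \<le> f x"
proof -
  have "compact (sphere (0::'a) 1)" "sphere (0::'a) 1 \<noteq> {}"
    by auto
  then obtain y where y: "y \<in> sphere 0 1" "\<And>x. x \<in> sphere 0 1 \<Longrightarrow> f y \<le> f x"
    using continuous_attains_inf[of "sphere (0::'a) 1" f] continuous_on_subset[OF cont] by blast
  have "f y * (norm x)\<^sup>2 \<le> f x" for x
  proof (cases "x = 0")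
    case True
    then show ?thesis using scale[of 0 0] by simp
  next
    case False
    then have "f y \<le> f (x /\<^sub>R norm x)" by (intro y) simp
    also have "\<dots> = f x / (norm x)\<^sup>2" by (simp add: scale power_inverse divide_inverse_commute)
    finally show ?thesis using False by (simp add: field_simps)
  qed
  moreover have "f y > 0" using y(1) by (intro pos) auto
  ultimately show thesis using that by blast
qed

lemma continuous_on_matrix_form:
  fixes Q :: "real^'n^'n"
  shows "continuous_on S (\<lambda>x. x \<bullet> (Q *v x))"
  by (intro continuous_intros linear_continuous_on_compose matrix_vector_mul_linear)

lemma matrix_form_scaleR:
  fixes Q :: "real^'n^'n"
  shows "(c *\<^sub>R x) \<bullet> (Q *v (c *\<^sub>R x)) = c\<^sup>2 * (x \<bullet> (Q *v x))"
  by (simp add: matrix_vector_mult_scaleR power2_eq_square)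

text \<open>The storage function lies between two multiples of the squared norm, and its decay rate
  dominates a third one. Hence V' \<le> -k V along trajectories, and the integrating factor exp(k t)
  turns this into exponential decay.\<close>

lemma lyapunov_exponential_decay:
  fixes P M :: "real^'n^'n"
  assumes P: "pos_definite P"
    and decr: "\<And>x. x \<noteq> 0 \<Longrightarrow> x \<bullet> (P *v (M *v x)) < 0"
  obtains K k where "K > 0" "k > 0"
    "\<And>x t. is_trajectory M x \<Longrightarrow> t \<ge> 0 \<Longrightarrow> (norm (x t))\<^sup>2 \<le> K * (norm (x 0))\<^sup>2 * exp (- k * t)"
proof -
  define V where "V x = x \<bullet> (P *v x)" for x
  obtain m where m: "m > 0" "\<And>x. m * (norm x)\<^sup>2 \<le> V x"
  proof (rule quadratic_lower_bound)
    show "continuous_on UNIV V"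
      unfolding V_def by (rule continuous_on_matrix_form)
    show "V (c *\<^sub>R x) = c\<^sup>2 * V x" for c x
      unfolding V_def by (rule matrix_form_scaleR)
    show "V x > 0" if "x \<noteq> 0" for x
      using P that by (simp add: V_def pos_definite_def)
  qed (use that in blast)
  obtain L where L: "L > 0" "\<And>x. norm (P *v x) \<le> norm x * L"
    using bounded_linear.pos_bounded[OF matrix_vector_mul_bounded_linear] by blast
  have V_le: "V x \<le> L * (norm x)\<^sup>2" for x
  proof -
    have "V x \<le> norm x * norm (P *v x)" unfolding V_def by (rule norm_cauchy_schwarz)
    also have "\<dots> \<le> norm x * (norm x * L)" by (intro mult_left_mono L) auto
    finally show ?thesis by (simp add: power2_eq_square mult_ac)
  qed
  \<comment> \<open>\<open>W\<close> is minus half the derivative of \<open>V\<close> along the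
    flow. Writing it as the form of one matrix makes the continuity and scaling lemmas for matrix
    forms applicable.\<close>
  define W where "W x = x \<bullet> ((- (P ** M)) *v x)" for x
  have neg: "(- Q) *v x = - (Q *v x)" for Q :: "real^'n^'n" and x
    by (simp add: matrix_vector_mult_def vec_eq_iff sum_negf)
  have W: "W x = - (x \<bullet> (P *v (M *v x)))" for x
    by (simp add: W_def neg matrix_vector_mul_assoc)
  obtain r where r: "r > 0" "\<And>x. r * (norm x)\<^sup>2 \<le> W x"
  proof (rule quadratic_lower_bound)
    show "continuous_on UNIV W"
      unfolding W_def by (rule continuous_on_matrix_form)
    show "W (c *\<^sub>R x) = c\<^sup>2 * W x" for c x
      unfolding W_def by (rule matrix_form_scaleR)
    show "W x > 0" if "x \<noteq> 0" for x
      using decr[OF that] by (simp add: W)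
  qed (use that in blast)
  \<comment> \<open>The rate comes from V' = -2 W \<le> -2 r |x|^2 \<le> -(2 r / L) V.\<close>
  define k where "k = 2 * r / L"
  have k: "k > 0" using r L by (simp add: k_def)
  have W_ge: "k * V x \<le> 2 * W x" for x
  proof -
    have "k * V x \<le> k * (L * (norm x)\<^sup>2)" using k by (intro mult_left_mono V_le) auto
    also have "\<dots> = 2 * (r * (norm x)\<^sup>2)" using L by (simp add: k_def)
    finally show ?thesis using r(2)[of x] by linarith
  qed
  \<comment> \<open>Symmetry of \<open>P\<close> makes the two terms of the product rule for
    \<open>V\<close> coincide.\<close>
  have sym: "(P *v y) \<bullet> x = y \<bullet> (P *v x)" for x y
    using P dot_lmul_matrix[of y P x] transpose_matrix_vector[of P y]
    by (simp add: pos_definite_def)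
  have "(norm (x t))\<^sup>2 \<le> L / m * (norm (x 0))\<^sup>2 * exp (- k * t)"
    if x: "is_trajectory M x" and t: "t \<ge> 0" for x t
  proof -
    define E where "E s = exp (k * s) * V (x s)" for s
    have E': "(E has_real_derivative exp (k * s) * (k * V (x s) - 2 * W (x s))) (at s within {0..})"
      if "s \<ge> 0" for s
    proof -
      have dx: "(x has_vector_derivative M *v x s) (at s within {0..})"
        using x that by (simp add: is_trajectory_def)
      have dP: "((\<lambda>s. P *v x s) has_vector_derivative P *v (M *v x s)) (at s within {0..})"
        by (rule bounded_linear.has_vector_derivative[OF matrix_vector_mul_bounded_linear dx])
      have "((\<lambda>s. V (x s)) has_vector_derivative x s \<bullet> (P *v (M *v x s)) + (M *v x s) \<bullet> (P *v x s))
          (at s within {0..})"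
        unfolding V_def
        by (rule bounded_bilinear.has_vector_derivative[OF bounded_bilinear_inner dx dP])
      moreover have "(M *v x s) \<bullet> (P *v x s) = x s \<bullet> (P *v (M *v x s))"
        by (metis sym inner_commute)
      ultimately have "((\<lambda>s. V (x s)) has_real_derivative - 2 * W (x s)) (at s within {0..})"
        by (simp add: has_real_derivative_iff_has_vector_derivative W)
      then show ?thesis
        unfolding E_def by (auto intro!: derivative_eq_intros simp: algebra_simps)
    qed
    \<comment> \<open>At time 0 only a one-sided derivative is available, so monotonicity is derived
      from the derivative at interior points and continuity on the closed interval.\<close>
    have "E t \<le> E 0"
    proof (rule DERIV_nonpos_imp_decreasing_open[OF t])
      show "\<exists>y. DERIV E s :> y \<and> y \<le> 0" if "0 < s" "s < t" for s
      proof -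
        have "at s within {0..} = at s"
          using that by (intro at_within_interior) auto
        then show ?thesis
          using E'[of s] W_ge[of "x s"] that by (auto simp: mult_le_0_iff)
      qed
      have "continuous_on {0..} E"
        using E' by (intro DERIV_continuous_on) auto
      then show "continuous_on {0..t} E"
        by (rule continuous_on_subset) auto
    qed
    then have "V (x t) \<le> V (x 0) * exp (- k * t)"
      by (simp add: E_def exp_minus field_simps)
    also have "\<dots> \<le> L * (norm (x 0))\<^sup>2 * exp (- k * t)"
      by (intro mult_right_mono V_le) auto
    finally have "m * (norm (x t))\<^sup>2 \<le> L * (norm (x 0))\<^sup>2 * exp (- k * t)"
      using m(2)[of "x t"] by linarith
    then show ?thesis using m by (simp add: field_simps)
  qed
  then show thesis using that[of "L / m" k] k L m by simp
qed

text \<open>The exponential bound yields both halves: dropping the exponential factor gives Lyapunov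
  stability, letting t tend to infinity gives attractivity.\<close>

lemma lyapunov_asymptotically_stable:
  fixes P M :: "real^'n^'n"
  assumes "pos_definite P"
    and "\<And>x. x \<noteq> 0 \<Longrightarrow> x \<bullet> (P *v (M *v x)) < 0"
  shows "asymptotically_stable M"
proof -
  obtain K k where K: "K > 0" and k: "k > 0" and decay:
    "\<And>x t. is_trajectory M x \<Longrightarrow> t \<ge> 0 \<Longrightarrow> (norm (x t))\<^sup>2 \<le> K * (norm (x 0))\<^sup>2 * exp (- k * t)"
    using lyapunov_exponential_decay[OF assms] by blast
  have "\<exists>\<delta>>0. \<forall>x. is_trajectory M x \<and> norm (x 0) < \<delta> \<longrightarrow> (\<forall>t\<ge>0. norm (x t) < \<epsilon>)"
    if \<epsilon>: "\<epsilon> > 0" for \<epsilon>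
  proof (intro exI conjI allI impI)
    \<comment> \<open>This \<delta> solves K \<delta>^2 = \<epsilon>^2.\<close>
    show "\<epsilon> / sqrt K > 0" using \<epsilon> K by simp
    fix x t
    assume x: "is_trajectory M x \<and> norm (x 0) < \<epsilon> / sqrt K" and t: "t \<ge> (0::real)"
    have "(norm (x t))\<^sup>2 \<le> K * (norm (x 0))\<^sup>2 * exp (- k * t)" using x t decay by blast
    also have "\<dots> \<le> K * (norm (x 0))\<^sup>2 * 1"
      using K k t by (intro mult_left_mono) auto
    also have "\<dots> < K * (\<epsilon> / sqrt K)\<^sup>2 * 1"
      using K x by (simp add: power_strict_mono)
    also have "\<dots> = \<epsilon>\<^sup>2" using K by (simp add: power_divide)
    finally show "norm (x t) < \<epsilon>" using \<epsilon> by (simp add: power2_less_imp_less)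
  qed
  moreover have "(x \<longlongrightarrow> 0) at_top" if x: "is_trajectory M x" for x
  proof -
    have "((\<lambda>t. exp (- (k * t))) \<longlongrightarrow> 0) at_top"
      using k by (intro filterlim_compose[OF exp_at_bot]
          filterlim_compose[OF filterlim_uminus_at_bot_at_top]
          filterlim_tendsto_pos_mult_at_top[OF tendsto_const] filterlim_ident)
    then have "((\<lambda>t. K * (norm (x 0))\<^sup>2 * exp (- k * t)) \<longlongrightarrow> 0) at_top"
      by (auto intro: tendsto_mult_right_zero)
    then have "((\<lambda>t. (norm (x t))\<^sup>2) \<longlongrightarrow> 0) at_top"
      by (rule tendsto_0_le[where K = 1])
        (use decay[OF x] K in
          \<open>auto intro!: eventually_mono[OF eventually_ge_at_top[of "0::real"]]\<close>)
    then have "((\<lambda>t. sqrt ((norm (x t))\<^sup>2)) \<longlongrightarrow> sqrt 0) at_top"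
      by (rule tendsto_real_sqrt)
    then show ?thesis by (simp add: tendsto_norm_zero_iff)
  qed
  \<comment> \<open>Attraction holds from every initial value, so \<delta> = 1 serves as the
    witness.\<close>
  ultimately show ?thesis
    unfolding asymptotically_stable_def using zero_less_one by blast
qed

section \<open>Quadratic supplies and their sign under the coupling\<close>

lemma quadratic_form_compose_linear:
  assumes "quadratic_form q" "linear f"
  shows "quadratic_form (\<lambda>z. q (f z))"
proof -
  obtain b where b: "bilinear b" "\<And>z. q z = b z z"
    using assms(1) by (auto simp: quadratic_form_def)
  have "bilinear (\<lambda>x y. b (f x) (f y))"
    using b(1) assms(2) by (auto simp: bilinear_def intro: linear_compose[unfolded o_def])
  then show ?thesis using b(2) by (auto simp: quadratic_form_def)
qed

text \<open>\<open>X\<close> collects both mixed values of the bilinear form, which may be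
  nonsymmetric. It is fixed before \<alpha> and \<beta>, so expansions with different scalings or
  signs can be compared.\<close>

lemma quadratic_form_pair_expansion:
  assumes "quadratic_form (\<lambda>(v, w). q v w)"
  obtains X where "\<And>\<alpha> \<beta> v w. q (\<alpha> *\<^sub>R v) (\<beta> *\<^sub>R w) = \<alpha>\<^sup>2 * q v 0 + \<alpha> * \<beta> * X v w + \<beta>\<^sup>2 * q 0 w"
proof -
  obtain b where b: "bilinear b" and q: "\<And>v w. q v w = b (v, w) (v, w)"
    using assms by (auto simp: quadratic_form_def)
  have "q (\<alpha> *\<^sub>R v) (\<beta> *\<^sub>R w) = \<alpha>\<^sup>2 * q v 0 + \<alpha> * \<beta> * (b (v, 0) (0, w) + b (0, w) (v, 0)) + \<beta>\<^sup>2 * q 0 w"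
    for \<alpha> \<beta> v w
  proof -
    have "(\<alpha> *\<^sub>R v, \<beta> *\<^sub>R w) = \<alpha> *\<^sub>R (v, 0) + \<beta> *\<^sub>R (0, w)" by simp
    then show ?thesis
      unfolding q
      by (simp only: bilinear_ladd[OF b] bilinear_radd[OF b] bilinear_lmul[OF b] bilinear_rmul[OF b])
        (simp add: algebra_simps power2_eq_square)
  qed
  then show thesis by (rule that)
qed

lemma coupled_supply_nonpos:
  fixes sA :: "real^'p::finite \<Rightarrow> real^'q::finite \<Rightarrow> real" and sB :: "real^'q \<Rightarrow> real^'p \<Rightarrow> real"
  assumes quad: "quadratic_form (\<lambda>(v, w). additive_supply sA sB v w)"
    and neutral: "\<And>wA wB. sA wB wA + sB wA wB = 0"
    and sA: "\<And>wA. wA \<noteq> 0 \<Longrightarrow> sA 0 wA \<le> 0"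
    and sB: "\<And>wB. wB \<noteq> 0 \<Longrightarrow> sB 0 wB \<le> 0"
    and \<alpha>: "\<alpha> \<in> {0..1}"
  shows "additive_supply sA sB (coupling \<alpha> *v w) w \<le> 0"
proof -
  \<comment> \<open>Only the sum of the two supplies is assumed quadratic, so each one may carry a constant.\<close>
  define hA where "hA v w = sA v w - sA 0 0" for v w
  define hB where "hB v w = sB v w - sB 0 0" for v w
  have const: "sA 0 0 + sB 0 0 = 0" by (rule neutral)
  have h: "sA v w + sB v' w' = hA v w + hB v' w'" for v w v' w'
    using const by (simp add: hA_def hB_def)
  \<comment> \<open>This embedding sets the second channel to zero; the supply pulled back along it
    is \<open>sA v w + sB 0 0\<close>, which equals \<open>hA v w\<close> by
    \<open>const\<close>.\<close>
  have "linear (\<lambda>z. (col (fst z) 0, col (snd z) 0))"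
    by (rule linearI) (auto simp: col_def vec_eq_iff split: sum.split)
  from quadratic_form_compose_linear[OF quad this]
  have "quadratic_form (\<lambda>(v, w). hA v w)"
    using const by (simp add: additive_supply_def hA_def case_prod_unfold add_eq_0_iff)
  then obtain X where X: "\<And>\<alpha> \<beta> v w. hA (\<alpha> *\<^sub>R v) (\<beta> *\<^sub>R w)
      = \<alpha>\<^sup>2 * hA v 0 + \<alpha> * \<beta> * X v w + \<beta>\<^sup>2 * hA 0 w"
    by (rule quadratic_form_pair_expansion) blast
  have "linear (\<lambda>z. (col 0 (fst z), col 0 (snd z)))"
    by (rule linearI) (auto simp: col_def vec_eq_iff split: sum.split)
  from quadratic_form_compose_linear[OF quad this]
  have "quadratic_form (\<lambda>(v, w). hB v w)"
    using const by (simp add: additive_supply_def hB_def case_prod_unfold add.commute add_eq_0_iff)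
  then obtain Y where Y: "\<And>\<alpha> \<beta> v w. hB (\<alpha> *\<^sub>R v) (\<beta> *\<^sub>R w)
      = \<alpha>\<^sup>2 * hB v 0 + \<alpha> * \<beta> * Y v w + \<beta>\<^sup>2 * hB 0 w"
    by (rule quadratic_form_pair_expansion) blast
  define a b where "a = upper w" and "b = lower w"
  have N: "hA v w + hB w v = 0" for v w using neutral h by metis
  \<comment> \<open>Half the sum of \<open>eq1\<close> and \<open>eq2\<close> cancels the pure terms
    against each other, and half the difference makes the mixed terms vanish.\<close>
  have eq1: "hA b 0 + X b a + hA 0 a + (hB a 0 + Y a b + hB 0 b) = 0"
    using N[of b a] X[of 1 b 1 a] Y[of 1 a 1 b] by simp
  have eq2: "hA b 0 - X b a + hA 0 a + (hB a 0 - Y a b + hB 0 b) = 0"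
    using N[of b "- a"] X[of 1 b "-1" a] Y[of "-1" a 1 b] by simp
  \<comment> \<open>The constant disappears because the bound scales quadratically.\<close>
  have nonpos: "y \<le> 0" if "\<And>n::nat. n > 0 \<Longrightarrow> (real n)\<^sup>2 * y \<le> c" for y c
  proof (rule ccontr)
    assume y: "\<not> y \<le> 0"
    obtain n :: nat where n: "c / y < real n" using reals_Archimedean2 by blast
    \<comment> \<open>Passing to \<open>Suc n\<close> meets the positivity premise and allows n to
      be bounded by n^2.\<close>
    have "c < real (Suc n) * y" using n y by (simp add: field_simps)
    also have "\<dots> \<le> (real (Suc n))\<^sup>2 * y"
      using y by (intro mult_right_mono) (simp_all add: power2_eq_square)
    finally show False using that[of "Suc n"] by simp
  qed
  have "hA 0 a \<le> 0"
  \<comment> \<open>Hypothesis (b) speaks of nonzero outputs only; it is applied to all positive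
    integer multiples of \<open>a\<close>. At zero, \<open>hA\<close> vanishes by its
    definition.\<close>
  proof (cases "a = 0")
    case False
    show ?thesis
    proof (rule nonpos)
      fix n :: nat assume "n > 0"
      then have "sA 0 (real n *\<^sub>R a) \<le> 0" using False by (intro sA) simp
      then show "(real n)\<^sup>2 * hA 0 a \<le> - sA 0 0"
        using X[of 0 0 "real n" a] by (simp add: hA_def)
    qed
  qed (simp add: hA_def)
  moreover have "hB 0 b \<le> 0"
  proof (cases "b = 0")
    case False
    show ?thesis
    proof (rule nonpos)
      fix n :: nat assume "n > 0"
      then have "sB 0 (real n *\<^sub>R b) \<le> 0" using False by (intro sB) simp
      then show "(real n)\<^sup>2 * hB 0 b \<le> - sB 0 0"
        using Y[of 0 0 "real n" b] by (simp add: hB_def)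
    qed
  qed (simp add: hB_def)
  \<comment> \<open>The range of \<alpha> enters here, as 1 - \<alpha>^2 \<ge> 0.\<close>
  ultimately have le: "(1 - \<alpha>\<^sup>2) * (hA 0 a + hB 0 b) \<le> 0"
    using \<alpha> by (intro mult_nonneg_nonpos) (auto simp: power_le_one)
  have "coupling \<alpha> *v w = col (\<alpha> *\<^sub>R b) (\<alpha> *\<^sub>R a)"
    using coupling_mult_col[of \<alpha> a b] by (simp add: a_def b_def)
  then have "additive_supply sA sB (coupling \<alpha> *v w) w = hA (\<alpha> *\<^sub>R b) a + hB (\<alpha> *\<^sub>R a) b"
    by (simp add: additive_supply_def h a_def b_def)
  also have "\<dots> = \<alpha>\<^sup>2 * (hA b 0 + hB a 0) + \<alpha> * (X b a + Y a b) + (hA 0 a + hB 0 b)"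
    using X[of \<alpha> b 1 a] Y[of \<alpha> a 1 b] by (simp add: algebra_simps)
  also have "hA b 0 + hB a 0 = - (hA 0 a + hB 0 b)" using eq1 eq2 by linarith
  also have "X b a + Y a b = 0" using eq1 eq2 by linarith
  finally show ?thesis using le by (simp add: algebra_simps)
qed

section \<open>Stability of closed loops from strict dissipativity\<close>

text \<open>Along v = H w the supply is nonpositive, so the dissipation inequality becomes a strict
  Lyapunov inequality for the closed loop.\<close>

lemma strictly_dissipative_interconnection_stable:
  fixes A :: "real^'n^'n" and B :: "real^'m^'n" and C :: "real^'n^'k" and D :: "real^'m^'k"
    and H :: "real^'k^'m"
  assumes diss: "strictly_dissipative A B C D s P"
    and P: "pos_definite P"
    and s: "\<And>w. s (H *v w) w \<le> 0"
  shows "interconnection_stable A B C D H"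
proof -
  define T where "T = mat 1 - D ** H"
  have T: "T *v w = w - D *v (H *v w)" for w
    by (simp add: T_def matrix_vector_mult_diff_rdistrib matrix_vector_mul_assoc)
  have "w = 0" if "T *v w = 0" for w
  proof (rule ccontr)
    assume "w \<noteq> 0"
    have w: "w = D *v (H *v w)" using that T by simp
    \<comment> \<open>If \<open>H *v w\<close> were zero, then w = D 0 = 0. So the pair (0, H w) is
      nonzero and strictness applies to it, with left-hand side 0.\<close>
    with \<open>w \<noteq> 0\<close> have "H *v w \<noteq> 0" by (metis matrix_vector_mult_0_right)
    with diss have "2 * (0 \<bullet> (P *v (A *v 0 + B *v (H *v w)))) < s (H *v w) (C *v 0 + D *v (H *v w))"
      unfolding strictly_dissipative_def by blast
    then show False using s[of w] w by simp
  qed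
  then have inv: "invertible T"
    by (simp add: invertible_left_inverse matrix_left_invertible_ker)
  have "asymptotically_stable (closed_loop A B C D H)"
  proof (rule lyapunov_asymptotically_stable[OF P])
    fix x :: "real^'n" assume x: "x \<noteq> 0"
    \<comment> \<open>This is the output that the loop produces in state x: T w = C x says exactly w
      = C x + D H w.\<close>
    define w where "w = matrix_inv T *v (C *v x)"
    have "T ** matrix_inv T = mat 1"
      \<comment> \<open>\<open>matrix_inv\<close> is a choice term; invertibility supplies the
        existence that makes it a genuine inverse.\<close>
      using someI_ex[OF inv[unfolded invertible_def]] by (simp add: matrix_inv_def)
    then have "T *v w = C *v x" unfolding w_def by (metis matrix_vector_mul_assoc matrix_vector_mul_lid)
    then have w: "C *v x + D *v (H *v w) = w" using T by (simp add: algebra_simps)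
    have "closed_loop A B C D H *v x = A *v x + B *v (H *v w)"
      by (simp add: closed_loop_def w_def T_def matrix_vector_mult_add_rdistrib
          flip: matrix_vector_mul_assoc)
    moreover have "2 * (x \<bullet> (P *v (A *v x + B *v (H *v w)))) < s (H *v w) (C *v x + D *v (H *v w))"
      using diss x unfolding strictly_dissipative_def by blast
    ultimately show "x \<bullet> (P *v (closed_loop A B C D H *v x)) < 0"
      using s[of w] w by simp
  qed
  then show ?thesis
    using inv by (simp add: interconnection_stable_def well_posed_def T_def)
qed

theorem lemma5p1:
  fixes A :: "real^'n^'n"
    and B :: "real^('p::finite + 'q::finite)^'n"
    and C :: "real^'n^('q::finite + 'p::finite)"
    and D :: "real^('p::finite + 'q::finite)^('q::finite + 'p::finite)"
    and P :: "real^'n^'n"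
    and sA :: "real^'p \<Rightarrow> real^'q \<Rightarrow> real"
    and sB :: "real^'q \<Rightarrow> real^'p \<Rightarrow> real"
  assumes "quadratic_form (\<lambda>(v, w). additive_supply sA sB v w)"
    and "transpose P = P"
    and "strictly_dissipative A B C D (additive_supply sA sB) P"
    and "\<And>vA vB wA wB. vA = wB \<Longrightarrow> vB = wA \<Longrightarrow> sA vA wA + sB vB wB = 0"
    and "\<And>wA. wA \<noteq> 0 \<Longrightarrow> sA 0 wA \<le> 0"
    and "\<And>wB. wB \<noteq> 0 \<Longrightarrow> sB 0 wB \<le> 0"
    and "pos_definite P"
  shows "asymptotically_stable A \<and>
    (\<forall>\<alpha>\<in>{0..1}. interconnection_stable A B C D (coupling \<alpha>))"
proof (intro conjI ballI)
  have nonpos_supply: "additive_supply sA sB (coupling \<alpha> *v w) w \<le> 0" if "\<alpha> \<in> {0..1}" for \<alpha> w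
    using that assms(1,4-6) by (intro coupled_supply_nonpos) auto
  show "interconnection_stable A B C D (coupling \<alpha>)" if "\<alpha> \<in> {0..1}" for \<alpha>
    using assms(3,7) nonpos_supply[OF that] by (rule strictly_dissipative_interconnection_stable)
  \<comment> \<open>The system with v = 0 is the case \<alpha> = 0: the coupling matrix vanishes and
    the closed loop reduces to \<open>A\<close>.\<close>
  have zero: "coupling 0 = (0 :: real^('q + 'p)^('p + 'q))"
    by (auto simp: coupling_def vec_eq_iff split: sum.split)
  have "closed_loop A B C D 0 = A"
    by (simp add: closed_loop_def)
  moreover have "interconnection_stable A B C D 0"
    using assms(3,7) nonpos_supply[of 0] unfolding zero
    by (intro strictly_dissipative_interconnection_stable) auto
  ultimately show "asymptotically_stable A"
    by (simp add: interconnection_stable_def)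
qed

end
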